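(* Let $\mathcal X$ be an infinite dimensional complex Banach space and let $A\in B(\mathcal X)$. Let $L_A,R_A\in B(B(\mathcal X))$ be the operators $L_A(T)=AT$, $R_A(T)=TA$. Then $a$-Weyl's theorem holds for both $L_A$ and $R_A$.
   Context: For a complex Banach space $\mathcal Z$, $B(\mathcal Z)$ is the Banach algebra of bounded linear operators on $\mathcal Z$. For $T\in B(\mathcal Z)$, $N(T)$, $R(T)$ are the null space and range; $T-\lambda$ means $T-\lambda I$; $\alpha(T)=\dim N(T)$, $\beta(T)=\dim \mathcal Z/R(T)$. $T$ is bounded below if $N(T)=0$ and $R(T)$ is closed; $\sigma_a(T)=\{\lambda\in\mathbb C:T-\lambda\text{ is not bounded below}\}$. $T$ is upper semi-Fredholm if $R(T)$ is closed and $\alpha(T)<\infty$, with index $\mathrm{ind}(T)=\alpha(T)-\beta(T)\in\mathbb Z\cup\{-\infty\}$. $\sigma_{aw}(T)=\{\lambda\in\sigma_a(T): T-\lambda\text{ is not upper semi-Fredholm or }0<\mathrm{ind}(T-\lambda)\}$. For $K\subseteq\mathbb C$, $\mathrm{iso}\,K$ is the set of isolated points of $K$. $E^a_0(T)=\{\lambda\in\mathrm{iso}\,\sigma_a(T):0<\alpha(T-\lambda)<\infty\}$. $a$-Weyl's theorem holds for $T$ if $\sigma_{aw}(T)=\sigma_a(T)\setminus E^a_0(T)$. *)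

theory Defs
  imports "HOL-Analysis.Analysis" "HOL-Library.Set_Algebras"
begin

section \<open>Complex Banach spaces\<close>

class complex_banach = banach +
  fixes scaleC :: "complex \<Rightarrow> 'a \<Rightarrow> 'a" (infixr \<open>*\<^sub>C\<close> 75)
  assumes scaleC_add_right: "a *\<^sub>C (x + y) = a *\<^sub>C x + a *\<^sub>C y"
    and scaleC_add_left: "(a + b) *\<^sub>C x = a *\<^sub>C x + b *\<^sub>C x"
    and scaleC_scaleC: "a *\<^sub>C b *\<^sub>C x = (a * b) *\<^sub>C x"
    and scaleC_one: "1 *\<^sub>C x = x"
    and scaleR_scaleC: "scaleR r x = complex_of_real r *\<^sub>C x"
    and norm_scaleC: "norm (a *\<^sub>C x) = cmod a * norm x"

global_interpretation complex_vector: vector_space "scaleC :: complex \<Rightarrow> 'a \<Rightarrow> 'a::complex_banach"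
  by unfold_locales (rule scaleC_add_right scaleC_add_left scaleC_scaleC scaleC_one)+

lemma bounded_linear_scaleC: "bounded_linear (\<lambda>x::'a::complex_banach. c *\<^sub>C x)"
  by (rule bounded_linear_intro[where K = "cmod c"])
    (simp_all add: scaleC_add_right scaleR_scaleC scaleC_scaleC norm_scaleC mult.commute)

section \<open>The Banach space of bounded complex-linear operators\<close>

text \<open>The library's \<open>'a \<Rightarrow>\<^sub>L 'a\<close> consists of the bounded real-linear maps, with the operator norm;
  \<open>'a bop\<close> is its closed subspace of complex-linear maps.\<close>

typedef (overloaded) 'a bop =
  "{T :: 'a::complex_banach \<Rightarrow>\<^sub>L 'a. \<forall>c x. blinfun_apply T (c *\<^sub>C x) = c *\<^sub>C blinfun_apply T x}"
  morphisms blinfun_of_bop bop_of_blinfun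
  by (rule exI[of _ 0]) (simp add: complex_vector.scale_zero_right)

setup_lifting type_definition_bop

abbreviation bop_apply :: "'a::complex_banach bop \<Rightarrow> 'a \<Rightarrow> 'a" (infixl \<open>\<cdot>\<close> 95)
  where "T \<cdot> x \<equiv> blinfun_apply (blinfun_of_bop T) x"

definition Bop :: "('a::complex_banach \<Rightarrow> 'a) \<Rightarrow> 'a bop"
  where "Bop f = bop_of_blinfun (Blinfun f)"

lemma bop_apply_scaleC: "T \<cdot> (c *\<^sub>C x) = c *\<^sub>C (T \<cdot> x)"
  using blinfun_of_bop[of T] by simp

lemma bop_apply_Bop:
  assumes "bounded_linear f" and "\<And>c x. f (c *\<^sub>C x) = c *\<^sub>C f x"
  shows "Bop f \<cdot> x = f x"
  using assms by (simp add: Bop_def bop_of_blinfun_inverse bounded_linear_Blinfun_apply)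

lemma bop_eqI: "(\<And>x. S \<cdot> x = T \<cdot> x) \<Longrightarrow> S = T"
  by (metis blinfun_eqI blinfun_of_bop_inject)

instantiation bop :: (complex_banach) real_normed_vector
begin

lift_definition zero_bop :: "'a bop" is 0
  by (simp add: complex_vector.scale_zero_right)

lift_definition plus_bop :: "'a bop \<Rightarrow> 'a bop \<Rightarrow> 'a bop" is "(+)"
  by (simp add: blinfun.add_left scaleC_add_right)

lift_definition minus_bop :: "'a bop \<Rightarrow> 'a bop \<Rightarrow> 'a bop" is "(-)"
  by (simp add: blinfun.diff_left complex_vector.scale_right_diff_distrib)

lift_definition uminus_bop :: "'a bop \<Rightarrow> 'a bop" is uminus
  by (simp add: blinfun.minus_left complex_vector.scale_minus_right)

lift_definition scaleR_bop :: "real \<Rightarrow> 'a bop \<Rightarrow> 'a bop" is scaleR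
  by (simp add: blinfun.scaleR_left scaleR_scaleC scaleC_scaleC mult.commute)

lift_definition norm_bop :: "'a bop \<Rightarrow> real" is norm .

lift_definition dist_bop :: "'a bop \<Rightarrow> 'a bop \<Rightarrow> real" is dist .

definition sgn_bop :: "'a bop \<Rightarrow> 'a bop"
  where "sgn_bop T = scaleR (inverse (norm T)) T"

definition uniformity_bop :: "('a bop \<times> 'a bop) filter"
  where "uniformity_bop = (INF e\<in>{0<..}. principal {(S, T). dist S T < e})"

definition open_bop :: "'a bop set \<Rightarrow> bool"
  where "open_bop U = (\<forall>S\<in>U. \<forall>\<^sub>F (S', T) in uniformity. S' = S \<longrightarrow> T \<in> U)"

instance
proof
  fix S T U :: "'a bop" and a b :: real and X :: "'a bop set"
  show "S + T + U = S + (T + U)" by transfer simp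
  show "S + T = T + S" by transfer simp
  show "0 + S = S" by transfer simp
  show "- S + S = 0" by transfer simp
  show "S - T = S + - T" by transfer simp
  show "a *\<^sub>R (S + T) = a *\<^sub>R S + a *\<^sub>R T" by transfer (rule scaleR_add_right)
  show "(a + b) *\<^sub>R S = a *\<^sub>R S + b *\<^sub>R S" by transfer (rule scaleR_add_left)
  show "a *\<^sub>R b *\<^sub>R S = (a * b) *\<^sub>R S" by transfer simp
  show "1 *\<^sub>R S = S" by transfer simp
  show "dist S T = norm (S - T)" by transfer (rule dist_norm)
  show "sgn S = inverse (norm S) *\<^sub>R S" by (rule sgn_bop_def)
  show "uniformity = (INF e\<in>{0<..}. principal {(S, T::'a bop). dist S T < e})"
    by (rule uniformity_bop_def)
  show "open X = (\<forall>S\<in>X. \<forall>\<^sub>F (S', T) in uniformity. S' = S \<longrightarrow> T \<in> X)"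
    by (rule open_bop_def)
  show "(norm S = 0) = (S = 0)" by transfer simp
  show "norm (S + T) \<le> norm S + norm T" by transfer (rule norm_triangle_ineq)
  show "norm (a *\<^sub>R S) = \<bar>a\<bar> * norm S" by transfer simp
qed

end

instantiation bop :: (complex_banach) complex_banach
begin

definition scaleC_bop :: "complex \<Rightarrow> 'a bop \<Rightarrow> 'a bop"
  where "scaleC_bop c T = Bop (\<lambda>x. c *\<^sub>C (T \<cdot> x))"

lemma bop_scaleC: "(c *\<^sub>C T) \<cdot> x = c *\<^sub>C (T \<cdot> x)" for T :: "'a bop"
  unfolding scaleC_bop_def
  by (rule bop_apply_Bop)
    (auto intro!: bounded_linear_compose[OF bounded_linear_scaleC] blinfun.bounded_linear_right
      simp: bop_apply_scaleC scaleC_scaleC mult.commute)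

lemma bop_add: "(S + T) \<cdot> x = S \<cdot> x + T \<cdot> x" for S T :: "'a bop"
  by (simp add: plus_bop.rep_eq blinfun.add_left)

instance
proof
  fix S T :: "'a bop" and a b :: complex and r :: real
  show "a *\<^sub>C (S + T) = a *\<^sub>C S + a *\<^sub>C T"
    by (rule bop_eqI) (simp add: bop_scaleC bop_add scaleC_add_right)
  show "(a + b) *\<^sub>C S = a *\<^sub>C S + b *\<^sub>C S"
    by (rule bop_eqI) (simp add: bop_scaleC bop_add scaleC_add_left)
  show "a *\<^sub>C b *\<^sub>C S = (a * b) *\<^sub>C S"
    by (rule bop_eqI) (simp add: bop_scaleC scaleC_scaleC)
  show "1 *\<^sub>C S = S"
    by (rule bop_eqI) (simp add: bop_scaleC scaleC_one)
  show "r *\<^sub>R S = complex_of_real r *\<^sub>C S"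
    by (rule bop_eqI) (simp add: bop_scaleC scaleR_bop.rep_eq blinfun.scaleR_left scaleR_scaleC)
  have le: "norm (c *\<^sub>C T) \<le> cmod c * norm T" for c and T :: "'a bop"
    unfolding norm_bop.rep_eq
  proof (rule norm_blinfun_bound)
    show "norm ((c *\<^sub>C T) \<cdot> x) \<le> cmod c * norm (blinfun_of_bop T) * norm x" for x
      unfolding bop_scaleC norm_scaleC mult.assoc
      by (intro mult_left_mono norm_blinfun norm_ge_zero)
  qed simp
  show "norm (a *\<^sub>C S) = cmod a * norm S"
  proof (cases "a = 0")
    case True
    then show ?thesis using le[of 0 S] by simp
  next
    case False
    have "S = inverse a *\<^sub>C a *\<^sub>C S"
      by (rule bop_eqI) (simp add: bop_scaleC scaleC_scaleC scaleC_one False)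
    then have "norm S \<le> cmod (inverse a) * norm (a *\<^sub>C S)"
      using le by metis
    then have "cmod a * norm S \<le> cmod a * (cmod (inverse a) * norm (a *\<^sub>C S))"
      by (intro mult_left_mono) simp_all
    also have "\<dots> = norm (a *\<^sub>C S)"
      using False by (simp add: norm_inverse)
    finally have "cmod a * norm S \<le> norm (a *\<^sub>C S)" .
    then show ?thesis using le[of a S] by simp
  qed
next
  fix X :: "nat \<Rightarrow> 'a bop"
  assume "Cauchy X"
  then have "Cauchy (\<lambda>n. blinfun_of_bop (X n))"
    by (simp add: Cauchy_def dist_bop.rep_eq)
  then obtain L where L: "(\<lambda>n. blinfun_of_bop (X n)) \<longlonglongrightarrow> L"
    by (auto simp: Cauchy_convergent_iff convergent_def)
  have lim: "(\<lambda>n. X n \<cdot> x) \<longlonglongrightarrow> blinfun_apply L x" for x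
    using L by (rule blinfun.tendsto[OF _ tendsto_const])
  have "blinfun_apply L (c *\<^sub>C x) = c *\<^sub>C blinfun_apply L x" for c x
  proof (rule LIMSEQ_unique[OF lim])
    show "(\<lambda>n. X n \<cdot> (c *\<^sub>C x)) \<longlonglongrightarrow> c *\<^sub>C blinfun_apply L x"
      unfolding bop_apply_scaleC by (rule bounded_linear.tendsto[OF bounded_linear_scaleC lim])
  qed
  then have "blinfun_of_bop (bop_of_blinfun L) = L"
    by (simp add: bop_of_blinfun_inverse)
  then have "X \<longlonglongrightarrow> bop_of_blinfun L"
    using L by (simp add: tendsto_iff dist_bop.rep_eq)
  then show "convergent X" by (auto simp: convergent_def)
qed

end

definition id_bop :: "'a::complex_banach bop"
  where "id_bop = Bop (\<lambda>x. x)"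

definition comp_bop :: "'a::complex_banach bop \<Rightarrow> 'a bop \<Rightarrow> 'a bop" (infixl \<open>\<circ>\<^sub>B\<close> 55)
  where "S \<circ>\<^sub>B T = Bop (\<lambda>x. S \<cdot> (T \<cdot> x))"

lemma bop_id: "id_bop \<cdot> x = x"
  unfolding id_bop_def by (rule bop_apply_Bop) (auto intro: bounded_linear_ident)

lemma bop_comp: "(S \<circ>\<^sub>B T) \<cdot> x = S \<cdot> (T \<cdot> x)"
  unfolding comp_bop_def
  by (rule bop_apply_Bop)
    (auto intro!: bounded_linear_compose[OF blinfun.bounded_linear_right]
      blinfun.bounded_linear_right simp: bop_apply_scaleC)

lemma norm_comp_bop: "norm (S \<circ>\<^sub>B T) \<le> norm S * norm T"
  unfolding norm_bop.rep_eq
proof (rule norm_blinfun_bound)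
  fix x
  have "norm (S \<cdot> (T \<cdot> x)) \<le> norm (blinfun_of_bop S) * norm (T \<cdot> x)"
    by (rule norm_blinfun)
  also have "\<dots> \<le> norm (blinfun_of_bop S) * (norm (blinfun_of_bop T) * norm x)"
    by (intro mult_left_mono norm_blinfun norm_ge_zero)
  finally show "norm ((S \<circ>\<^sub>B T) \<cdot> x) \<le> norm (blinfun_of_bop S) * norm (blinfun_of_bop T) * norm x"
    by (simp add: bop_comp mult.assoc)
qed simp

definition left_mult :: "'a::complex_banach bop \<Rightarrow> 'a bop bop"
  where "left_mult A = Bop (\<lambda>T. A \<circ>\<^sub>B T)"

definition right_mult :: "'a::complex_banach bop \<Rightarrow> 'a bop bop"
  where "right_mult A = Bop (\<lambda>T. T \<circ>\<^sub>B A)"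

lemma left_mult_apply: "left_mult A \<cdot> T = A \<circ>\<^sub>B T"
  unfolding left_mult_def
proof (rule bop_apply_Bop)
  show "bounded_linear (\<lambda>T. A \<circ>\<^sub>B T)"
    by (rule bounded_linear_intro[where K = "norm A"])
      (auto intro!: bop_eqI norm_comp_bop[THEN order_trans] simp: bop_comp bop_add bop_scaleC
        scaleR_scaleC blinfun.add_right bop_apply_scaleC)
  show "A \<circ>\<^sub>B (c *\<^sub>C T) = c *\<^sub>C (A \<circ>\<^sub>B T)" for c T
    by (rule bop_eqI) (simp add: bop_comp bop_scaleC bop_apply_scaleC)
qed

lemma right_mult_apply: "right_mult A \<cdot> T = T \<circ>\<^sub>B A"
  unfolding right_mult_def
proof (rule bop_apply_Bop)
  show "bounded_linear (\<lambda>T. T \<circ>\<^sub>B A)"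
    by (rule bounded_linear_intro[where K = "norm A"])
      (auto intro!: bop_eqI norm_comp_bop[THEN order_trans] simp: bop_comp bop_add bop_scaleC
        scaleR_scaleC)
  show "(c *\<^sub>C T) \<circ>\<^sub>B A = c *\<^sub>C (T \<circ>\<^sub>B A)" for c T
    by (rule bop_eqI) (simp add: bop_comp bop_scaleC)
qed

section \<open>Dimension, possibly infinite\<close>

text \<open>\<open>complex_vector.dim\<close> is a natural number and is 0 on infinite-dimensional spaces, so the
  dimension of a subspace is taken in \<open>enat\<close>; see \<open>edim_eq_dim\<close> for the agreement.\<close>

definition edim :: "'a::complex_banach set \<Rightarrow> enat"
  where "edim S = (SUP B \<in> {B. B \<subseteq> S \<and> finite B \<and> complex_vector.independent B}. enat (card B))"

lemma edim_eq_dim: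
  assumes "finite C" and "S \<subseteq> complex_vector.span C"
  shows "edim S = enat (complex_vector.dim S)"
proof -
  obtain B where B: "B \<subseteq> S" "complex_vector.independent B" "S \<subseteq> complex_vector.span B"
    "card B = complex_vector.dim S"
    by (rule complex_vector.basis_exists)
  have "finite B"
    using complex_vector.independent_span_bound[OF assms(1) B(2)] B(1) assms(2) by auto
  show ?thesis
    unfolding edim_def
  proof (rule antisym[OF SUP_least])
    fix D assume D: "D \<in> {B. B \<subseteq> S \<and> finite B \<and> complex_vector.independent B}"
    then have "card D \<le> card B"
      using complex_vector.independent_span_bound[OF \<open>finite B\<close>, of D] B(3) by auto
    then show "enat (card D) \<le> enat (complex_vector.dim S)" using B(4) by simp
  next
    show "enat (complex_vector.dim S)
      \<le> (SUP B \<in> {B. B \<subseteq> S \<and> finite B \<and> complex_vector.independent B}. enat (card B))"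
      using B \<open>finite B\<close> by (intro SUP_upper2[of B]) auto
  qed
qed

lemma edim_eq_infinity:
  assumes "\<nexists>C. finite C \<and> S \<subseteq> complex_vector.span C"
  shows "edim S = \<infinity>"
proof -
  have ex: "\<exists>B. B \<subseteq> S \<and> finite B \<and> complex_vector.independent B \<and> card B = n" for n
  proof (induction n)
    case 0
    show ?case by (rule exI[of _ "{}"]) (simp add: complex_vector.independent_empty)
  next
    case (Suc n)
    then obtain B where B: "B \<subseteq> S" "finite B" "complex_vector.independent B" "card B = n" by blast
    with assms obtain x where x: "x \<in> S" "x \<notin> complex_vector.span B" by blast
    then have "x \<notin> B" using complex_vector.span_base by blast
    then show ?case
      using B x by (intro exI[of _ "insert x B"]) (simp add: complex_vector.independent_insertI)
  qed
  have "enat n \<le> edim S" for n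
    using ex[of n] unfolding edim_def by (auto intro: SUP_upper2)
  then have "enat (Suc n) \<le> edim S" for n .
  then show ?thesis
    by (cases "edim S") (metis Suc_n_not_le_n enat_ord_simps(1), simp)
qed

text \<open>The quotient by a subspace \<open>W\<close> consists of the cosets \<open>z + W\<close>; its zero is \<open>W\<close> and its
  addition is the sum of sets from \<^theory>\<open>HOL-Library.Set_Algebras\<close>. In the scalar multiple,
  adding \<open>W\<close> matters only for \<open>c = 0\<close>, where the elementwise multiple would be \<open>{0}\<close>.\<close>

definition quotient_space :: "'a::complex_banach set \<Rightarrow> 'a set set"
  where "quotient_space W = range (\<lambda>z. z +o W)"

definition quotient_scaleC :: "'a::complex_banach set \<Rightarrow> complex \<Rightarrow> 'a set \<Rightarrow> 'a set"
  where "quotient_scaleC W c Q = (\<lambda>q. c *\<^sub>C q) ` Q + W"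

lemma
  fixes W :: "'a::complex_banach set"
  assumes "complex_vector.subspace W"
  shows coset_add: "(x +o W) + (y +o W) = (x + y) +o W"
    and coset_scaleC: "quotient_scaleC W c (x +o W) = (c *\<^sub>C x) +o W"
proof -
  have WW: "W + W = W"
  proof
    show "W + W \<subseteq> W"
      using assms by (auto simp: set_plus_def complex_vector.subspace_add)
    show "W \<subseteq> W + W"
      using set_zero_plus2[OF complex_vector.subspace_0[OF assms]] .
  qed
  then show "(x +o W) + (y +o W) = (x + y) +o W"
    by (metis set_plus_rearrange)
  show "quotient_scaleC W c (x +o W) = (c *\<^sub>C x) +o W"
  proof
    show "quotient_scaleC W c (x +o W) \<subseteq> (c *\<^sub>C x) +o W"
      unfolding quotient_scaleC_def
    proof
      fix v assume "v \<in> (\<lambda>q. c *\<^sub>C q) ` (x +o W) + W"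
      then obtain w w' where w: "w \<in> W" "w' \<in> W" "v = c *\<^sub>C (x + w) + w'"
        by (auto simp: set_plus_def elt_set_plus_def)
      then have "v = c *\<^sub>C x + (c *\<^sub>C w + w')"
        by (simp add: scaleC_add_right add.assoc)
      moreover have "c *\<^sub>C w + w' \<in> W"
        using assms w by (simp add: complex_vector.subspace_add complex_vector.subspace_scale)
      ultimately show "v \<in> (c *\<^sub>C x) +o W" by (auto simp: elt_set_plus_def)
    qed
    show "(c *\<^sub>C x) +o W \<subseteq> quotient_scaleC W c (x +o W)"
    proof
      fix v assume "v \<in> (c *\<^sub>C x) +o W"
      then obtain w where w: "w \<in> W" "v = c *\<^sub>C x + w"
        by (auto simp: elt_set_plus_def)
      have "x \<in> x +o W"
        using complex_vector.subspace_0[OF assms] by (force simp: elt_set_plus_def)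
      then show "v \<in> quotient_scaleC W c (x +o W)"
        unfolding quotient_scaleC_def w(2) by (intro set_plus_intro imageI w)
    qed
  qed
qed

definition quotient_independent :: "'a::complex_banach set \<Rightarrow> 'a set set \<Rightarrow> bool"
  where "quotient_independent W F \<longleftrightarrow>
    (\<forall>c. (\<Sum>Q\<in>F. quotient_scaleC W (c Q) Q) = W \<longrightarrow> (\<forall>Q\<in>F. c Q = 0))"

definition quotient_edim :: "'a::complex_banach set \<Rightarrow> enat"
  where "quotient_edim W =
    (SUP F \<in> {F. F \<subseteq> quotient_space W \<and> finite F \<and> quotient_independent W F}. enat (card F))"

section \<open>Approximate point spectrum and a-Weyl's theorem\<close>

definition null_space :: "'a::complex_banach bop \<Rightarrow> 'a set"
  where "null_space T = {x. T \<cdot> x = 0}"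

definition range_space :: "'a::complex_banach bop \<Rightarrow> 'a set"
  where "range_space T = range (\<lambda>x. T \<cdot> x)"

definition nullity :: "'a::complex_banach bop \<Rightarrow> enat"
  where "nullity T = edim (null_space T)"

definition defect :: "'a::complex_banach bop \<Rightarrow> enat"
  where "defect T = quotient_edim (range_space T)"

definition bounded_below :: "'a::complex_banach bop \<Rightarrow> bool"
  where "bounded_below T \<longleftrightarrow> null_space T = {0} \<and> closed (range_space T)"

definition upper_semi_Fredholm :: "'a::complex_banach bop \<Rightarrow> bool"
  where "upper_semi_Fredholm T \<longleftrightarrow> closed (range_space T) \<and> nullity T < \<infinity>"

text \<open>Meaningful for upper semi-Fredholm operators only, where the value is an integer or \<open>-\<infinity>\<close>.\<close>

definition index :: "'a::complex_banach bop \<Rightarrow> ereal"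
  where "index T = ereal_of_enat (nullity T) - ereal_of_enat (defect T)"

definition approx_spectrum :: "'a::complex_banach bop \<Rightarrow> complex set"
  where "approx_spectrum T = {l. \<not> bounded_below (T - l *\<^sub>C id_bop)}"

definition weyl_approx_spectrum :: "'a::complex_banach bop \<Rightarrow> complex set"
  where "weyl_approx_spectrum T = {l \<in> approx_spectrum T.
    \<not> upper_semi_Fredholm (T - l *\<^sub>C id_bop) \<or> 0 < index (T - l *\<^sub>C id_bop)}"

definition isolated_approx_eigenvalues :: "'a::complex_banach bop \<Rightarrow> complex set"
  where "isolated_approx_eigenvalues T = {l. l isolated_in approx_spectrum T \<and>
    0 < nullity (T - l *\<^sub>C id_bop) \<and> nullity (T - l *\<^sub>C id_bop) < \<infinity>}"

definition a_weyl :: "'a::complex_banach bop \<Rightarrow> bool"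
  where "a_weyl T \<longleftrightarrow>
    weyl_approx_spectrum T = approx_spectrum T - isolated_approx_eigenvalues T"

end

theory Submission
  imports Defs
begin

text \<open>For every scalar \<open>l\<close>, the kernels of \<open>left_mult A - l\<close> and \<open>right_mult A - l\<close> are either
  zero or infinite-dimensional. Indeed, a nonzero \<open>T\<close> in the first kernel supplies a nonzero \<open>x\<close>
  with \<open>A x = l x\<close>, and then every rank-one operator \<open>y \<mapsto> f y x\<close> lies in that kernel; a nonzero
  \<open>T\<close> in the second one supplies a nonzero functional \<open>g = f \<circ> T\<close> with \<open>g \<circ> A = l g\<close>, and then
  every \<open>y \<mapsto> g y z\<close> lies in that kernel. The first family is infinite-dimensional
  because the dual space is, the second one because the space itself is.

  An operator with this dichotomy satisfies a-Weyl's theorem trivially: no eigenvalue has finite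
  multiplicity, so there are no isolated approximate eigenvalues of the relevant kind, while a
  point of the approximate spectrum has either an infinite-dimensional kernel or a non-closed
  range, and fails to be upper semi-Fredholm in both cases.

  Both the choice of \<open>f\<close> and the size of the dual space rest on the fact that bounded functionals
  separate points, which is the Hahn--Banach theorem; it is proved here by minimizing sublinear
  functionals.\<close>

section \<open>The Hahn--Banach theorem\<close>

definition sublinear :: "('a::real_vector \<Rightarrow> real) \<Rightarrow> bool"
  where "sublinear p \<longleftrightarrow>
    (\<forall>x y. p (x + y) \<le> p x + p y) \<and> (\<forall>r x. 0 \<le> r \<longrightarrow> p (r *\<^sub>R x) = r * p x)"

lemma sublinear_add: "sublinear p \<Longrightarrow> p (x + y) \<le> p x + p y"
  and sublinear_scaleR: "sublinear p \<Longrightarrow> 0 \<le> r \<Longrightarrow> p (r *\<^sub>R x) = r * p x"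
  by (auto simp: sublinear_def)

lemma sublinear_0: "sublinear p \<Longrightarrow> p 0 = 0"
  using sublinear_scaleR[of p 0 0] by simp

lemma sublinear_ge_minus: "sublinear p \<Longrightarrow> - p (- x) \<le> p x"
  using sublinear_add[of p x "- x"] sublinear_0[of p] by simp

text \<open>One inequality in the homogeneity suffices: the other one follows by rescaling with the
  inverse factor.\<close>

lemma sublinearI:
  assumes add: "\<And>x y. p (x + y) \<le> p x + p y"
    and scale: "\<And>r x. 0 < r \<Longrightarrow> p (r *\<^sub>R x) \<le> r * p x"
    and zero: "p 0 \<le> 0"
  shows "sublinear p"
  unfolding sublinear_def
proof (intro conjI allI impI add)
  fix r :: real and x
  assume "0 \<le> r"
  show "p (r *\<^sub>R x) = r * p x"
  proof (cases "r = 0")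
    case True
    then show ?thesis using zero add[of 0 0] by simp
  next
    case False
    with \<open>0 \<le> r\<close> have r: "0 < r" by simp
    then have "p x \<le> inverse r * p (r *\<^sub>R x)"
      using scale[of "inverse r" "r *\<^sub>R x"] by simp
    then have "r * p x \<le> p (r *\<^sub>R x)"
      using r by (simp add: field_simps)
    with scale[OF r] show ?thesis by (simp add: antisym)
  qed
qed

text \<open>Subtracting the growth of \<open>p\<close> along the ray of \<open>y\<close> replaces \<open>p\<close> by a smaller sublinear
  functional that is linear in the direction \<open>y\<close>. It serves twice: to force the value of a functional at a given vector,
  and to see that a minimal sublinear functional is additive.\<close>

definition flatten :: "'a::real_vector \<Rightarrow> ('a \<Rightarrow> real) \<Rightarrow> 'a \<Rightarrow> real"
  where "flatten y p x = (INF t\<in>{0..}. p (x + t *\<^sub>R y) - t * p y)"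

lemma flatten_le:
  assumes p: "sublinear p" and t: "0 \<le> t"
  shows "flatten y p x \<le> p (x + t *\<^sub>R y) - t * p y"
  unfolding flatten_def
proof (rule cINF_lower)
  show "bdd_below ((\<lambda>t. p (x + t *\<^sub>R y) - t * p y) ` {0..})"
  proof (rule bdd_belowI2)
    fix s :: real assume "s \<in> {0..}"
    then show "- p (- x) \<le> p (x + s *\<^sub>R y) - s * p y"
      using sublinear_add[OF p, of "x + s *\<^sub>R y" "- x"] sublinear_scaleR[OF p, of s y] by simp
  qed
qed (use t in simp)

lemma le_flatten:
  assumes "\<And>t. 0 \<le> t \<Longrightarrow> a \<le> p (x + t *\<^sub>R y) - t * p y"
  shows "a \<le> flatten y p x"
  unfolding flatten_def using assms by (intro cINF_greatest) auto

lemma flatten_le_self: "sublinear p \<Longrightarrow> flatten y p \<le> p"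
  using flatten_le[of p 0 y] by (simp add: le_fun_def)

lemma sublinear_flatten:
  assumes p: "sublinear p"
  shows "sublinear (flatten y p)"
proof (rule sublinearI)
  fix x z
  have "flatten y p (x + z) - (p (x + s *\<^sub>R y) - s * p y) \<le> p (z + t *\<^sub>R y) - t * p y"
    if "0 \<le> s" "0 \<le> t" for s t
    using flatten_le[OF p, of "s + t" y "x + z"] that
      sublinear_add[OF p, of "x + s *\<^sub>R y" "z + t *\<^sub>R y"]
    by (simp add: algebra_simps)
  then have "flatten y p (x + z) - (p (x + s *\<^sub>R y) - s * p y) \<le> flatten y p z" if "0 \<le> s" for s
    using that by (intro le_flatten) auto
  then have "flatten y p (x + z) - flatten y p z \<le> flatten y p x"
    by (intro le_flatten) (simp add: algebra_simps)
  then show "flatten y p (x + z) \<le> flatten y p x + flatten y p z" by simp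
next
  fix r :: real and x
  assume r: "0 < r"
  have "flatten y p (r *\<^sub>R x) / r \<le> p (x + t *\<^sub>R y) - t * p y" if "0 \<le> t" for t
  proof -
    have "flatten y p (r *\<^sub>R x) \<le> p (r *\<^sub>R (x + t *\<^sub>R y)) - (r * t) * p y"
      using flatten_le[OF p, of "r * t" y "r *\<^sub>R x"] r that by (simp add: scaleR_add_right)
    also have "\<dots> = r * (p (x + t *\<^sub>R y) - t * p y)"
      using sublinear_scaleR[OF p, of r "x + t *\<^sub>R y"] r
      by (simp add: right_diff_distrib mult.assoc)
    finally show ?thesis using r by (simp add: field_simps)
  qed
  then have "flatten y p (r *\<^sub>R x) / r \<le> flatten y p x" by (rule le_flatten)
  then show "flatten y p (r *\<^sub>R x) \<le> r * flatten y p x"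
    using r by (simp add: field_simps)
next
  show "flatten y p 0 \<le> 0"
    using flatten_le[OF p, of 0 y 0] sublinear_0[OF p] by simp
qed

lemma flatten_minus_le: "sublinear p \<Longrightarrow> flatten y p (- y) \<le> - p y"
  using flatten_le[of p 1 y "- y"] sublinear_0[of p] by simp

text \<open>Two members of a chain are dominated by the smaller one, which is subadditive; hence so is
  the pointwise infimum.\<close>

lemma sublinear_INF_chain:
  fixes C :: "('a::real_vector \<Rightarrow> real) set"
  assumes sub: "\<And>q. q \<in> C \<Longrightarrow> sublinear q" and le: "\<And>q. q \<in> C \<Longrightarrow> q \<le> p"
    and chain: "\<And>q r. q \<in> C \<Longrightarrow> r \<in> C \<Longrightarrow> q \<le> r \<or> r \<le> q" and ne: "C \<noteq> {}"
  defines "m \<equiv> \<lambda>x. INF q\<in>C. q x"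
  shows "sublinear m" and "\<And>q. q \<in> C \<Longrightarrow> m \<le> q"
proof -
  have "bdd_below ((\<lambda>q. q x) ` C)" for x
  proof (rule bdd_belowI2)
    fix q assume "q \<in> C"
    then show "- p (- x) \<le> q x"
      using sublinear_ge_minus[OF sub, of q x] le_funD[OF le, of q "- x"] by linarith
  qed
  then have lower: "m x \<le> q x" if "q \<in> C" for q x
    unfolding m_def using that by (rule cINF_lower)
  have greatest: "a \<le> m x" if "\<And>q. q \<in> C \<Longrightarrow> a \<le> q x" for a x
    unfolding m_def using ne that by (rule cINF_greatest)
  show "m \<le> q" if "q \<in> C" for q
    using lower[OF that] by (rule le_funI)
  show "sublinear m"
  proof (rule sublinearI)
    fix x y
    have "m (x + y) - q x \<le> r y" if q: "q \<in> C" and r: "r \<in> C" for q r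
    proof -
      consider "q \<le> r" | "r \<le> q" using chain[OF q r] by blast
      then show ?thesis
      proof cases
        case 1
        then show ?thesis
          using lower[OF q, of "x + y"] sublinear_add[OF sub[OF q], of x y] le_funD[OF 1, of y]
          by linarith
      next
        case 2
        then show ?thesis
          using lower[OF r, of "x + y"] sublinear_add[OF sub[OF r], of x y] le_funD[OF 2, of x]
          by linarith
      qed
    qed
    then have "m (x + y) - q x \<le> m y" if "q \<in> C" for q
      using that by (intro greatest)
    then have "m (x + y) - m y \<le> m x"
      by (intro greatest) (simp add: algebra_simps)
    then show "m (x + y) \<le> m x + m y" by simp
  next
    fix r :: real and x
    assume r: "0 < r"
    have "m (r *\<^sub>R x) / r \<le> q x" if "q \<in> C" for q
      using lower[OF that, of "r *\<^sub>R x"] sublinear_scaleR[OF sub[OF that], of r x] r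
      by (simp add: field_simps)
    then have "m (r *\<^sub>R x) / r \<le> m x" by (rule greatest)
    then show "m (r *\<^sub>R x) \<le> r * m x" using r by (simp add: field_simps)
  next
    obtain q where "q \<in> C" using ne by blast
    then show "m 0 \<le> 0" using lower[of q 0] sublinear_0[OF sub, of q] by simp
  qed
qed

text \<open>A minimal sublinear functional below \<open>p\<close>, given by Zorn's lemma, coincides with all its
  flattenings, and this is additivity.\<close>

theorem Hahn_Banach_dominated:
  assumes p: "sublinear p"
  obtains f where "linear f" and "\<And>x. f x \<le> p x"
proof -
  define S where "S = {q. sublinear q \<and> q \<le> p}"
  have "\<exists>f\<in>S. \<forall>q\<in>S. q \<le> f \<longrightarrow> q = f"
  proof (rule predicate_Zorn)
    show "partial_order_on S (relation_of (\<lambda>q r. r \<le> q) S)"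
      by (rule partial_order_on_relation_ofI) auto
  next
    fix C assume C: "C \<in> Chains (relation_of (\<lambda>q r. r \<le> q) S)"
    then have sub: "q \<in> S" if "q \<in> C" for q
      using that by (auto simp: Chains_def relation_of_def)
    have chain: "q \<le> r \<or> r \<le> q" if "q \<in> C" "r \<in> C" for q r
      using C that by (auto simp: Chains_def relation_of_def)
    show "\<exists>u\<in>S. \<forall>q\<in>C. u \<le> q"
    proof (cases "C = {}")
      case True
      then show ?thesis using p by (auto simp: S_def)
    next
      case False
      note inf = sublinear_INF_chain[of C p, OF _ _ chain False]
      let ?m = "\<lambda>x. INF q\<in>C. q x"
      have "sublinear ?m" and le: "\<And>q. q \<in> C \<Longrightarrow> ?m \<le> q"
        using inf sub by (auto simp: S_def)
      moreover obtain q where "q \<in> C" using False by blast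
      then have "?m \<le> p" using le[of q] sub[of q] by (auto simp: S_def)
      ultimately show ?thesis by (auto simp: S_def)
    qed
  qed
  then obtain f where f: "sublinear f" "f \<le> p"
    and min: "\<And>q. sublinear q \<Longrightarrow> q \<le> p \<Longrightarrow> q \<le> f \<Longrightarrow> q = f"
    unfolding S_def by blast
  have flat: "flatten y f = f" for y
    using sublinear_flatten[OF f(1)] flatten_le_self[OF f(1)] f(2) by (intro min) (auto intro: order_trans)
  have add: "f (x + y) = f x + f y" for x y
    using flatten_le[OF f(1), of 1 y x] sublinear_add[OF f(1), of x y] by (simp add: flat)
  have neg: "f (- x) = - f x" for x
    using add[of x "- x"] sublinear_0[OF f(1)] by simp
  have "f (r *\<^sub>R x) = r *\<^sub>R f x" for r x
  proof (cases "0 \<le> r")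
    case True
    then show ?thesis using sublinear_scaleR[OF f(1)] by simp
  next
    case False
    then show ?thesis using sublinear_scaleR[OF f(1), of "- r" x] neg[of "r *\<^sub>R x"] by simp
  qed
  with add have "linear f" by (rule linearI)
  then show ?thesis using f(2) that by (auto simp: le_fun_def)
qed

lemma sublinear_norm: "sublinear (norm :: 'a::real_normed_vector \<Rightarrow> real)"
  by (simp add: sublinear_def norm_triangle_ineq)

lemma real_functional_norming:
  fixes x0 :: "'a::real_normed_vector"
  obtains f :: "'a \<Rightarrow> real" where "linear f" "\<And>x. \<bar>f x\<bar> \<le> norm x" "f x0 = norm x0"
proof -
  obtain f where f: "linear f" "\<And>x. f x \<le> flatten x0 norm x"
    using Hahn_Banach_dominated[OF sublinear_flatten[OF sublinear_norm]] by blast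
  have le: "f x \<le> norm x" for x
    using f(2)[of x] le_funD[OF flatten_le_self[OF sublinear_norm], of x0 x] by linarith
  have abs: "\<bar>f x\<bar> \<le> norm x" for x
    using le[of x] le[of "- x"] linear_neg[OF f(1), of x] by simp
  have "- f x0 \<le> - norm x0"
    using f(2)[of "- x0"] flatten_minus_le[OF sublinear_norm, of x0] linear_neg[OF f(1), of x0]
    by simp
  then have "f x0 = norm x0" using le[of x0] by simp
  with f(1) abs that show ?thesis by blast
qed

section \<open>Bounded complex functionals\<close>

definition bounded_functional :: "('a::complex_banach \<Rightarrow> complex) \<Rightarrow> bool"
  where "bounded_functional f \<longleftrightarrow> bounded_linear f \<and> (\<forall>c x. f (c *\<^sub>C x) = c * f x)"

lemma bounded_functional_scaleC: "bounded_functional f \<Longrightarrow> f (c *\<^sub>C x) = c * f x"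
  and bounded_functional_linear: "bounded_functional f \<Longrightarrow> linear f"
  by (simp_all add: bounded_functional_def bounded_linear.linear)

lemma bounded_functional_comp_bop:
  assumes "bounded_functional f"
  shows "bounded_functional (\<lambda>x. f (T \<cdot> x))"
  using assms unfolding bounded_functional_def
  by (auto intro!: bounded_linear_compose[of f] blinfun.bounded_linear_right simp: bop_apply_scaleC)

text \<open>A real functional \<open>h\<close> is the real part of the complex functional
  \<open>x \<mapsto> h x - \<i> h (\<i> x)\<close>.\<close>

lemma bounded_functional_separates:
  fixes x0 :: "'a::complex_banach"
  assumes "x0 \<noteq> 0"
  obtains f where "bounded_functional f" and "f x0 = 1"
proof -
  obtain h :: "'a \<Rightarrow> real" where h: "linear h" "\<And>x. \<bar>h x\<bar> \<le> norm x" "h x0 = norm x0"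
    using real_functional_norming by blast
  define g where "g x = Complex (h x) (- h (\<i> *\<^sub>C x))" for x
  have hadd: "h (x + y) = h x + h y" for x y using h(1) by (rule linear_add)
  have hscale: "h (complex_of_real r *\<^sub>C x) = r * h x" for r x
    using linear_cmul[OF h(1), of r x] by (simp add: scaleR_scaleC)
  have gadd: "g (x + y) = g x + g y" for x y
    by (simp add: g_def hadd scaleC_add_right complex_eq_iff)
  have gscale: "g (c *\<^sub>C x) = c * g x" for c x
  proof -
    have "c *\<^sub>C x = complex_of_real (Re c) *\<^sub>C x + complex_of_real (Im c) *\<^sub>C \<i> *\<^sub>C x"
      by (simp add: scaleC_scaleC scaleC_add_left[symmetric] complex_eq_iff)
    then have 1: "h (c *\<^sub>C x) = Re c * h x + Im c * h (\<i> *\<^sub>C x)"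
      by (simp only: hadd hscale)
    have "\<i> *\<^sub>C c *\<^sub>C x = complex_of_real (Re c) *\<^sub>C \<i> *\<^sub>C x + complex_of_real (- Im c) *\<^sub>C x"
      unfolding scaleC_scaleC scaleC_add_left[symmetric]
      by (rule arg_cong[where f = "\<lambda>d. d *\<^sub>C x"]) (simp add: complex_eq_iff)
    then have 2: "h (\<i> *\<^sub>C c *\<^sub>C x) = Re c * h (\<i> *\<^sub>C x) - Im c * h x"
      by (simp only: hadd hscale)
    then show ?thesis by (simp add: g_def complex_eq_iff 1)
  qed
  have "bounded_linear g"
  proof (rule bounded_linear_intro[where K = 2])
    show "g (r *\<^sub>R x) = r *\<^sub>R g x" for r x
      by (simp add: scaleR_scaleC gscale scaleR_conv_of_real)
    show "norm (g x) \<le> norm x * 2" for x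
      using cmod_le[of "g x"] h(2)[of x] h(2)[of "\<i> *\<^sub>C x"] by (simp add: g_def norm_scaleC)
  qed (rule gadd)
  then have "bounded_functional (\<lambda>x. g x * inverse (g x0))"
    unfolding bounded_functional_def
    by (simp add: gscale bounded_linear_mult_const mult.assoc)
  moreover have "g x0 \<noteq> 0"
    using h(3) assms by (simp add: g_def complex_eq_iff)
  ultimately show ?thesis using that[of "\<lambda>x. g x * inverse (g x0)"] by simp
qed

text \<open>A space with finitely many functionals that separate points is finite-dimensional; the lemma
  says more generally that the common kernel of finitely many functionals has finite
  codimension.\<close>

lemma finite_functionals_finite_codim:
  fixes F :: "('a::complex_banach \<Rightarrow> complex) set"
  assumes "finite F" and "\<And>f. f \<in> F \<Longrightarrow> bounded_functional f"
  shows "\<exists>C. finite C \<and> (\<forall>y. \<exists>z\<in>complex_vector.span C. \<forall>f\<in>F. f (y - z) = 0)"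
  using assms
proof (induction F rule: finite_induct)
  case empty
  show ?case by (intro exI[of _ "{}"]) auto
next
  case (insert g F)
  then obtain C where C: "finite C"
    and z: "\<And>y. \<exists>z\<in>complex_vector.span C. \<forall>f\<in>F. f (y - z) = 0"
    by auto
  have g: "bounded_functional g" and F: "\<And>f. f \<in> F \<Longrightarrow> bounded_functional f"
    using insert.prems by auto
  show ?case
  proof (cases "\<forall>w. (\<forall>f\<in>F. f w = 0) \<longrightarrow> g w = 0")
    case True
    have "\<exists>z\<in>complex_vector.span C. \<forall>f\<in>insert g F. f (y - z) = 0" for y
    proof -
      obtain u where "u \<in> complex_vector.span C" "\<forall>f\<in>F. f (y - u) = 0" using z by blast
      with True show ?thesis by blast
    qed
    then show ?thesis using C by blast
  next
    case False
    then obtain v where v: "\<forall>f\<in>F. f v = 0" "g v \<noteq> 0" by blast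
    have "\<exists>z\<in>complex_vector.span (insert v C). \<forall>f\<in>insert g F. f (y - z) = 0" for y
    proof -
      obtain u where u: "u \<in> complex_vector.span C" "\<forall>f\<in>F. f (y - u) = 0" using z by blast
      define c where "c = g (y - u) / g v"
      have cg: "c * g v = g (y - u)" using v(2) by (simp add: c_def)
      have val: "f (y - (u + c *\<^sub>C v)) = f (y - u) - c * f v" if "bounded_functional f" for f
        using linear_diff[OF bounded_functional_linear[OF that], of "y - u" "c *\<^sub>C v"]
        by (simp add: bounded_functional_scaleC[OF that] diff_diff_eq)
      have "u + c *\<^sub>C v \<in> complex_vector.span (insert v C)"
        using complex_vector.span_mono[OF subset_insertI, of C v] u(1)
          complex_vector.span_base[OF insertI1, of v C]
        by (blast intro: complex_vector.span_add complex_vector.span_scale)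
      moreover have "\<forall>f\<in>insert g F. f (y - (u + c *\<^sub>C v)) = 0"
        using u(2) v(1) g F cg by (auto simp: val)
      ultimately show ?thesis by blast
    qed
    then show ?thesis using C by (intro exI[of _ "insert v C"]) auto
  qed
qed

section \<open>Rank-one operators\<close>

definition rank_one :: "'a::complex_banach \<Rightarrow> ('a \<Rightarrow> complex) \<Rightarrow> 'a bop"
  where "rank_one x f = Bop (\<lambda>y. f y *\<^sub>C x)"

lemma rank_one_apply:
  assumes f: "bounded_functional f"
  shows "rank_one x f \<cdot> y = f y *\<^sub>C x"
  unfolding rank_one_def
proof (rule bop_apply_Bop)
  obtain K where K: "\<And>y. norm (f y) \<le> norm y * K"
    using f bounded_linear.bounded unfolding bounded_functional_def by blast
  show "bounded_linear (\<lambda>y. f y *\<^sub>C x)"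
  proof (rule bounded_linear_intro[where K = "K * norm x"])
    show "f (u + v) *\<^sub>C x = f u *\<^sub>C x + f v *\<^sub>C x" for u v
      using linear_add[OF bounded_functional_linear[OF f]] by (simp add: scaleC_add_left)
    show "f (r *\<^sub>R u) *\<^sub>C x = r *\<^sub>R f u *\<^sub>C x" for r u
      using linear_cmul[OF bounded_functional_linear[OF f]]
      by (simp add: scaleR_scaleC scaleC_scaleC scaleR_conv_of_real)
    show "norm (f u *\<^sub>C x) \<le> norm u * (K * norm x)" for u
      using mult_right_mono[OF K norm_ge_zero[of x]] by (simp add: norm_scaleC mult.assoc)
  qed
  show "f (c *\<^sub>C u) *\<^sub>C x = c *\<^sub>C f u *\<^sub>C x" for c u
    by (simp add: bounded_functional_scaleC[OF f] scaleC_scaleC)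
qed

lemma infinite_dimensional_no_finite_span:
  assumes "edim S = \<infinity>" and "finite C"
  shows "\<not> S \<subseteq> complex_vector.span C"
  using edim_eq_dim[OF assms(2)] assms(1) by auto

text \<open>If finitely many operators \<open>S\<close> spanned all rank-one operators with range in the line of
  \<open>x\<close>, then composing them with a functional that does not vanish at \<open>x\<close> would give finitely many
  functionals that separate points.\<close>

lemma edim_rank_one_fixed_vector:
  fixes N :: "'x::complex_banach bop set"
  assumes inf: "edim (UNIV :: 'x set) = \<infinity>" and x: "x \<noteq> 0"
    and N: "\<And>f. bounded_functional f \<Longrightarrow> rank_one x f \<in> N"
  shows "edim N = \<infinity>"
proof (rule edim_eq_infinity, rule notI)
  assume "\<exists>C. finite C \<and> N \<subseteq> complex_vector.span C"
  then obtain C where C: "finite C" "N \<subseteq> complex_vector.span C" by blast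
  obtain h where h: "bounded_functional h" "h x = 1"
    using bounded_functional_separates[OF x] .
  have "finite ((\<lambda>S y. h (S \<cdot> y)) ` C)" using C(1) by simp
  from finite_functionals_finite_codim[OF this] bounded_functional_comp_bop[OF h(1)]
  obtain D where D: "finite D"
    and z: "\<And>y. \<exists>z\<in>complex_vector.span D. \<forall>S\<in>C. h (S \<cdot> (y - z)) = 0"
    by auto
  have zero: "y = 0" if y: "\<forall>S\<in>C. h (S \<cdot> y) = 0" for y
  proof (rule ccontr)
    assume "y \<noteq> 0"
    then obtain f where f: "bounded_functional f" "f y = 1"
      by (rule bounded_functional_separates)
    have "h (S \<cdot> y) = 0" if "S \<in> complex_vector.span C" for S
      using that
    proof (rule complex_vector.span_induct)
      show "complex_vector.subspace {S. h (S \<cdot> y) = 0}"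
        using linear_add[OF bounded_functional_linear[OF h(1)]]
          linear_0[OF bounded_functional_linear[OF h(1)]]
        by (intro complex_vector.subspaceI)
          (auto simp: bop_add bop_scaleC bounded_functional_scaleC[OF h(1)] zero_bop.rep_eq)
    qed (use y in auto)
    then have "h (rank_one x f \<cdot> y) = 0" using N[OF f(1)] C(2) by blast
    then show False
      using h f by (simp add: rank_one_apply scaleC_one)
  qed
  have "UNIV \<subseteq> complex_vector.span D"
  proof
    fix y
    obtain u where u: "u \<in> complex_vector.span D" "\<forall>S\<in>C. h (S \<cdot> (y - u)) = 0" using z by blast
    then show "y \<in> complex_vector.span D" using zero[OF u(2)] by simp
  qed
  with infinite_dimensional_no_finite_span[OF inf D] show False by blast
qed

text \<open>Evaluation at a vector where \<open>g\<close> has value 1 recovers \<open>x\<close> from \<open>rank_one x g\<close>, so a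
  finite spanning set for these operators would yield one for the whole space.\<close>

lemma edim_rank_one_fixed_functional:
  fixes N :: "'x::complex_banach bop set"
  assumes inf: "edim (UNIV :: 'x set) = \<infinity>" and g: "bounded_functional g" "g u = 1"
    and N: "\<And>x. rank_one x g \<in> N"
  shows "edim N = \<infinity>"
proof (rule edim_eq_infinity, rule notI)
  assume "\<exists>C. finite C \<and> N \<subseteq> complex_vector.span C"
  then obtain C where C: "finite C" "N \<subseteq> complex_vector.span C" by blast
  let ?D = "(\<lambda>S. S \<cdot> u) ` C"
  have ev: "S \<cdot> u \<in> complex_vector.span ?D" if "S \<in> complex_vector.span C" for S
    using that
  proof (rule complex_vector.span_induct)
    show "complex_vector.subspace {S. S \<cdot> u \<in> complex_vector.span ?D}"
      by (intro complex_vector.subspaceI)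
        (auto simp: bop_add bop_scaleC zero_bop.rep_eq complex_vector.span_zero
          intro: complex_vector.span_add complex_vector.span_scale)
  qed (auto intro: complex_vector.span_base)
  have "UNIV \<subseteq> complex_vector.span ?D"
  proof
    fix x
    show "x \<in> complex_vector.span ?D"
      using ev[of "rank_one x g"] N C(2) by (auto simp: rank_one_apply g scaleC_one)
  qed
  with infinite_dimensional_no_finite_span[OF inf] C(1) show False by blast
qed

section \<open>Multiplication operators\<close>

lemma bop_diff: "(S - T) \<cdot> x = S \<cdot> x - T \<cdot> x" for S T :: "'a::complex_banach bop"
  by (simp add: minus_bop.rep_eq blinfun.diff_left)

lemma mem_null_space_left_mult:
  "T \<in> null_space (left_mult A - l *\<^sub>C id_bop) \<longleftrightarrow> (\<forall>x. A \<cdot> (T \<cdot> x) = l *\<^sub>C (T \<cdot> x))"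
proof -
  have "T \<in> null_space (left_mult A - l *\<^sub>C id_bop) \<longleftrightarrow> A \<circ>\<^sub>B T = l *\<^sub>C T"
    by (simp add: null_space_def bop_diff bop_scaleC bop_id left_mult_apply)
  also have "\<dots> \<longleftrightarrow> (\<forall>x. (A \<circ>\<^sub>B T) \<cdot> x = (l *\<^sub>C T) \<cdot> x)"
    by (auto intro: bop_eqI)
  finally show ?thesis by (simp add: bop_comp bop_scaleC)
qed

lemma mem_null_space_right_mult:
  "T \<in> null_space (right_mult A - l *\<^sub>C id_bop) \<longleftrightarrow> (\<forall>x. T \<cdot> (A \<cdot> x) = l *\<^sub>C (T \<cdot> x))"
proof -
  have "T \<in> null_space (right_mult A - l *\<^sub>C id_bop) \<longleftrightarrow> T \<circ>\<^sub>B A = l *\<^sub>C T"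
    by (simp add: null_space_def bop_diff bop_scaleC bop_id right_mult_apply)
  also have "\<dots> \<longleftrightarrow> (\<forall>x. (T \<circ>\<^sub>B A) \<cdot> x = (l *\<^sub>C T) \<cdot> x)"
    by (auto intro: bop_eqI)
  finally show ?thesis by (simp add: bop_comp bop_scaleC)
qed

lemma nonzero_bop_value:
  fixes T :: "'a::complex_banach bop"
  assumes "T \<noteq> 0"
  obtains x where "T \<cdot> x \<noteq> 0"
  using assms by (metis bop_eqI zero_bop.rep_eq zero_blinfun.rep_eq)

lemma nonzero_in_null_space:
  assumes "null_space T \<noteq> {0}"
  obtains x where "x \<in> null_space T" "x \<noteq> 0"
proof -
  have "0 \<in> null_space T" by (simp add: null_space_def)
  with assms that show ?thesis by blast
qed

lemma left_mult_null_space_infinite: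
  fixes A :: "'x::complex_banach bop"
  assumes inf: "edim (UNIV :: 'x set) = \<infinity>"
    and "null_space (left_mult A - l *\<^sub>C id_bop) \<noteq> {0}"
  shows "nullity (left_mult A - l *\<^sub>C id_bop) = \<infinity>"
proof -
  obtain T where T: "T \<in> null_space (left_mult A - l *\<^sub>C id_bop)" "T \<noteq> 0"
    using assms(2) by (rule nonzero_in_null_space)
  obtain y where y: "T \<cdot> y \<noteq> 0" using T(2) by (rule nonzero_bop_value)
  have "A \<cdot> (T \<cdot> y) = l *\<^sub>C (T \<cdot> y)"
    using T(1) by (simp add: mem_null_space_left_mult)
  then have "rank_one (T \<cdot> y) f \<in> null_space (left_mult A - l *\<^sub>C id_bop)"
    if "bounded_functional f" for f
    using that
    by (simp add: mem_null_space_left_mult rank_one_apply bop_apply_scaleC scaleC_scaleC mult.commute)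
  then show ?thesis
    unfolding nullity_def by (rule edim_rank_one_fixed_vector[OF inf y])
qed

lemma right_mult_null_space_infinite:
  fixes A :: "'x::complex_banach bop"
  assumes inf: "edim (UNIV :: 'x set) = \<infinity>"
    and "null_space (right_mult A - l *\<^sub>C id_bop) \<noteq> {0}"
  shows "nullity (right_mult A - l *\<^sub>C id_bop) = \<infinity>"
proof -
  obtain T where T: "T \<in> null_space (right_mult A - l *\<^sub>C id_bop)" "T \<noteq> 0"
    using assms(2) by (rule nonzero_in_null_space)
  obtain y where y: "T \<cdot> y \<noteq> 0" using T(2) by (rule nonzero_bop_value)
  obtain f where f: "bounded_functional f" "f (T \<cdot> y) = 1"
    using y by (rule bounded_functional_separates)
  define g where "g x = f (T \<cdot> x)" for x
  have g: "bounded_functional g" "g y = 1"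
    using bounded_functional_comp_bop[OF f(1), of T] f(2) by (simp_all add: g_def[abs_def])
  have "g (A \<cdot> x) = l * g x" for x
    using T(1) by (simp add: g_def mem_null_space_right_mult bounded_functional_scaleC[OF f(1)])
  then have "rank_one z g \<in> null_space (right_mult A - l *\<^sub>C id_bop)" for z
    by (simp add: mem_null_space_right_mult rank_one_apply[OF g(1)] scaleC_scaleC)
  then show ?thesis
    unfolding nullity_def by (rule edim_rank_one_fixed_functional[OF inf g])
qed

section \<open>a-Weyl's theorem\<close>

text \<open>Both sides of a-Weyl's theorem reduce to the whole approximate spectrum: no kernel has finite
  nonzero dimension, and being upper semi-Fredholm becomes the same as being bounded below.\<close>

lemma a_weyl_if_kernels_zero_or_infinite:
  assumes "\<And>l. null_space (T - l *\<^sub>C id_bop) \<noteq> {0} \<Longrightarrow> nullity (T - l *\<^sub>C id_bop) = \<infinity>"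
  shows "a_weyl T"
proof -
  have "nullity S = 0" if "null_space S = {0}" for S :: "'a bop"
    using edim_eq_dim[of "{}" "{0 :: 'a}"] complex_vector.dim_le_card[of "{0}" "{}"] that
    by (simp add: nullity_def zero_enat_def)
  then have "isolated_approx_eigenvalues T = {}"
    using assms by (force simp: isolated_approx_eigenvalues_def)
  moreover have "weyl_approx_spectrum T = approx_spectrum T"
    using assms
    by (auto simp: weyl_approx_spectrum_def approx_spectrum_def bounded_below_def
        upper_semi_Fredholm_def)
  ultimately show ?thesis by (simp add: a_weyl_def)
qed

theorem theorem3p8:
  fixes A :: "'x::complex_banach bop"
  assumes "edim (UNIV :: 'x set) = \<infinity>"
  shows "a_weyl (left_mult A) \<and> a_weyl (right_mult A)"
  by (intro conjI a_weyl_if_kernels_zero_or_infinite left_mult_null_space_infinite[OF assms]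
      right_mult_null_space_infinite[OF assms])

end
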